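(* Let $(G,o)$ be a unimodular random graph. Then its annealed spectral radius is the essential supremum of the quenched spectral radii: $\rho_a=\operatorname{ess\,sup}_{(G,o)}\rho_q(G,o)$. In particular, if $(G,o)$ is ergodic, then $\rho_a=\rho_q(G,o)$ almost surely.
   Context: All graphs have vertex degrees bounded by a fixed $D\in\mathbb{N}$ and no isolated vertices. $\mathbb{G}_\bullet$ is the standard Borel space of isomorphism classes of connected rooted graphs $(G,o)$; $\mathbb{G}_{\bullet\bullet}$ is the space of isomorphism classes of connected doubly rooted graphs $(G,o,o')$. A unimodular random graph is a random element $(G,o)$ of $\mathbb{G}_\bullet$, with law $\nu$, satisfying the Mass Transport Principle: for every Borel $f:\mathbb{G}_{\bullet\bullet}\to\mathbb{R}_{\ge 0}$, $\int \sum_{o'\in V(G)} f(G,o',o)\,d\nu(G,o) = \int \sum_{o'\in V(G)} f(G,o,o')\,d\nu(G,o)$. It is ergodic if every Borel $U\subseteq\mathbb{G}_\bullet$ that is rerooting invariant ($(G,o)\in U$ implies $(G,o')\in U$ for all $o'\in V(G)$) has $\nu(U)\in\{0,1\}$. For $(G,o)\in\mathbb{G}_\bullet$ let $p_{2n}(G,o)=\mathbb{P}[X_{2n}=o]$, where $(X_i)$ is the simple random walk on $G$ started at $o$. The quenched spectral radius is the rerooting invariant random variable $\rho_q(G,o)=\lim_{n}\sqrt[2n]{p_{2n}(G,o)}$. The annealed spectral radius of the unimodular random graph is $\rho_a=\lim_n\sqrt[2n]{\mathbb{E}[p_{2n}(G,o)]}$, with expectation over the random rooted graph. The essential supremum is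 with respect to $\nu$. *)

theory Defs
  imports "HOL-Probability.Probability"
begin

text \<open>Locally finite connected graphs are countable, so every isomorphism class of such graphs
  has a representative whose vertices are natural numbers.\<close>

record graph =
  verts :: "nat set"
  edges :: "(nat \<times> nat) set"

definition neighbours :: "graph \<Rightarrow> nat \<Rightarrow> nat set" where
  "neighbours G v = {w. (v, w) \<in> edges G}"

definition conn_graph :: "graph \<Rightarrow> bool" where
  "conn_graph G \<longleftrightarrow>
     edges G \<subseteq> verts G \<times> verts G \<and> sym (edges G) \<and> irrefl (edges G) \<and>
     (\<forall>v\<in>verts G. \<forall>w\<in>verts G. (v, w) \<in> (edges G)\<^sup>*) \<and>
     (\<forall>v\<in>verts G. finite (neighbours G v) \<and> neighbours G v \<noteq> {})"

definition graph_iso :: "(nat \<Rightarrow> nat) \<Rightarrow> graph \<Rightarrow> graph \<Rightarrow> bool" where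
  "graph_iso \<phi> G H \<longleftrightarrow> bij_betw \<phi> (verts G) (verts H) \<and>
     (\<forall>v\<in>verts G. \<forall>w\<in>verts G. (v, w) \<in> edges G \<longleftrightarrow> (\<phi> v, \<phi> w) \<in> edges H)"

lemma graph_iso_id: "graph_iso (\<lambda>v. v) G G"
  by (auto simp: graph_iso_def bij_betw_def)

lemma graph_iso_comp:
  assumes "graph_iso \<phi> G H" "graph_iso \<psi> H K"
  shows "graph_iso (\<lambda>v. \<psi> (\<phi> v)) G K"
proof -
  have "\<phi> v \<in> verts H" if "v \<in> verts G" for v
    using assms(1) that by (auto simp: graph_iso_def bij_betw_def)
  then show ?thesis
    using assms bij_betw_trans[of \<phi> "verts G" "verts H" \<psi> "verts K"]
    by (auto simp: graph_iso_def o_def)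
qed

lemma graph_iso_inv:
  assumes "graph_iso \<phi> G H"
  shows "graph_iso (inv_into (verts G) \<phi>) H G"
proof -
  have b: "bij_betw \<phi> (verts G) (verts H)"
    using assms by (simp add: graph_iso_def)
  have "(v, w) \<in> edges H \<longleftrightarrow>
      (inv_into (verts G) \<phi> v, inv_into (verts G) \<phi> w) \<in> edges G"
    if "v \<in> verts H" "w \<in> verts H" for v w
  proof -
    have "inv_into (verts G) \<phi> v \<in> verts G" "inv_into (verts G) \<phi> w \<in> verts G"
      using that b by (auto simp: bij_betw_def intro: inv_into_into)
    then show ?thesis
      using assms that b by (auto simp: graph_iso_def bij_betw_inv_into_right)
  qed
  then show ?thesis
    using bij_betw_inv_into[OF b] by (auto simp: graph_iso_def)
qed

lemma graph_iso_sym: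
  assumes "graph_iso \<phi> G H"
  obtains \<psi> where "graph_iso \<psi> H G" "\<And>v. v \<in> verts G \<Longrightarrow> \<psi> (\<phi> v) = v"
  using graph_iso_inv[OF assms] assms
  by (metis graph_iso_def bij_betw_inv_into_left)

lemma graph_iso_in: "graph_iso \<phi> G H \<Longrightarrow> v \<in> verts G \<Longrightarrow> \<phi> v \<in> verts H"
  by (auto simp: graph_iso_def bij_betw_def)

lemma graph_iso_neighbours:
  assumes "graph_iso \<phi> G H" "conn_graph G" "conn_graph H" "v \<in> verts G"
  shows "bij_betw \<phi> (neighbours G v) (neighbours H (\<phi> v))"
proof -
  have sub: "neighbours G v \<subseteq> verts G" "neighbours H (\<phi> v) \<subseteq> verts H"
    using assms(2,3) by (auto simp: conn_graph_def neighbours_def)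
  have "inj_on \<phi> (neighbours G v)"
    using assms(1) sub(1) by (auto simp: graph_iso_def bij_betw_def intro: inj_on_subset)
  moreover have "\<phi> ` neighbours G v = neighbours H (\<phi> v)"
  proof
    show "\<phi> ` neighbours G v \<subseteq> neighbours H (\<phi> v)"
      using assms(1,4) sub(1) by (auto simp: graph_iso_def neighbours_def)
    show "neighbours H (\<phi> v) \<subseteq> \<phi> ` neighbours G v"
    proof
      fix w assume w: "w \<in> neighbours H (\<phi> v)"
      then obtain u where "u \<in> verts G" "w = \<phi> u"
        using sub(2) assms(1) unfolding graph_iso_def bij_betw_def by blast
      then show "w \<in> \<phi> ` neighbours G v"
        using w assms(1,4) by (auto simp: graph_iso_def neighbours_def)
    qed
  qed
  ultimately show ?thesis by (simp add: bij_betw_def)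
qed

lemma graph_iso_degrees_le:
  assumes "graph_iso \<phi> G H" "conn_graph G" "conn_graph H"
  shows "(\<forall>v\<in>verts G. card (neighbours G v) \<le> D) \<longleftrightarrow> (\<forall>v\<in>verts H. card (neighbours H v) \<le> D)"
proof -
  have "card (neighbours G v) = card (neighbours H (\<phi> v))" if "v \<in> verts G" for v
    using graph_iso_neighbours[OF assms that] by (rule bij_betw_same_card)
  moreover have "verts H = \<phi> ` verts G"
    using assms(1) by (simp add: graph_iso_def bij_betw_def)
  ultimately show ?thesis by simp
qed

definition rooted_iso :: "graph \<times> nat \<Rightarrow> graph \<times> nat \<Rightarrow> bool" where
  "rooted_iso = (\<lambda>(G, a) (H, b). conn_graph G \<and> a \<in> verts G \<and> conn_graph H \<and> b \<in> verts H \<and>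
     (\<exists>\<phi>. graph_iso \<phi> G H \<and> \<phi> a = b))"

definition doubly_rooted_iso :: "graph \<times> nat \<times> nat \<Rightarrow> graph \<times> nat \<times> nat \<Rightarrow> bool" where
  "doubly_rooted_iso = (\<lambda>(G, a, a') (H, b, b').
     conn_graph G \<and> a \<in> verts G \<and> a' \<in> verts G \<and> conn_graph H \<and> b \<in> verts H \<and> b' \<in> verts H \<and>
     (\<exists>\<phi>. graph_iso \<phi> G H \<and> \<phi> a = b \<and> \<phi> a' = b'))"

lemma conn_graph_edge: "conn_graph \<lparr>verts = {0, 1}, edges = {(0, 1), (1, 0)}\<rparr>"
proof -
  have "neighbours \<lparr>verts = {0, 1}, edges = {(0, 1), (1, 0)}\<rparr> v = (if v = 0 then {1} else if v = 1 then {0} else {})" for v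
    by (auto simp: neighbours_def)
  then show ?thesis
    by (auto simp: conn_graph_def sym_def irrefl_def)
qed

quotient_type rooted_graph = "graph \<times> nat" / partial: rooted_iso
proof (rule part_equivpI)
  let ?K = "\<lparr>verts = {0, 1}, edges = {(0, 1), (1, 0)}\<rparr>"
  show "\<exists>x. rooted_iso x x"
    using conn_graph_edge graph_iso_id[of ?K]
    by (intro exI[of _ "(?K, 0)"]) (auto simp: rooted_iso_def)
  show "symp rooted_iso"
  proof (rule sympI)
    fix x y assume "rooted_iso x y"
    then obtain G a H b \<phi> where *: "x = (G, a)" "y = (H, b)" "conn_graph G" "conn_graph H"
        "a \<in> verts G" "b \<in> verts H" "graph_iso \<phi> G H" "\<phi> a = b"
      unfolding rooted_iso_def by auto
    obtain \<psi> where "graph_iso \<psi> H G" "\<And>v. v \<in> verts G \<Longrightarrow> \<psi> (\<phi> v) = v"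
      using graph_iso_sym[OF \<open>graph_iso \<phi> G H\<close>] by blast
    with * show "rooted_iso y x"
      unfolding rooted_iso_def by (auto intro!: exI[of _ \<psi>])
  qed
  show "transp rooted_iso"
    by (rule transpI) (fastforce simp: rooted_iso_def intro: graph_iso_comp)
qed

quotient_type doubly_rooted_graph = "graph \<times> nat \<times> nat" / partial: doubly_rooted_iso
proof (rule part_equivpI)
  let ?K = "\<lparr>verts = {0, 1}, edges = {(0, 1), (1, 0)}\<rparr>"
  show "\<exists>x. doubly_rooted_iso x x"
    using conn_graph_edge graph_iso_id[of ?K]
    by (intro exI[of _ "(?K, 0, 0)"]) (auto simp: doubly_rooted_iso_def)
  show "symp doubly_rooted_iso"
  proof (rule sympI)
    fix x y assume "doubly_rooted_iso x y"
    then obtain G a a' H b b' \<phi> where *: "x = (G, a, a')" "y = (H, b, b')" "conn_graph G" "conn_graph H"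
        "a \<in> verts G" "a' \<in> verts G" "b \<in> verts H" "b' \<in> verts H" "graph_iso \<phi> G H" "\<phi> a = b" "\<phi> a' = b'"
      unfolding doubly_rooted_iso_def by auto
    obtain \<psi> where "graph_iso \<psi> H G" "\<And>v. v \<in> verts G \<Longrightarrow> \<psi> (\<phi> v) = v"
      using graph_iso_sym[OF \<open>graph_iso \<phi> G H\<close>] by blast
    with * show "doubly_rooted_iso y x"
      unfolding doubly_rooted_iso_def by (auto intro!: exI[of _ \<psi>])
  qed
  show "transp doubly_rooted_iso"
    by (rule transpI) (fastforce simp: doubly_rooted_iso_def intro: graph_iso_comp)
qed

lift_definition degrees_le :: "nat \<Rightarrow> rooted_graph \<Rightarrow> bool" is
  "\<lambda>D (G, a). \<forall>v\<in>verts G. card (neighbours G v) \<le> D"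
proof -
  fix D x y
  assume "rooted_iso x y"
  then obtain G a H b \<phi> where xy: "x = (G, a)" "y = (H, b)"
    and *: "graph_iso \<phi> G H" "conn_graph G" "conn_graph H"
    by (auto simp: rooted_iso_def)
  show "?thesis D x y"
    using graph_iso_degrees_le[OF *, of D] by (simp add: xy)
qed

lift_definition doubly_degrees_le :: "nat \<Rightarrow> doubly_rooted_graph \<Rightarrow> bool" is
  "\<lambda>D (G, a, b). \<forall>v\<in>verts G. card (neighbours G v) \<le> D"
proof -
  fix D x y
  assume "doubly_rooted_iso x y"
  then obtain G a a' H b b' \<phi> where xy: "x = (G, a, a')" "y = (H, b, b')"
    and *: "graph_iso \<phi> G H" "conn_graph G" "conn_graph H"
    by (auto simp: doubly_rooted_iso_def)
  show "?thesis D x y"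
    using graph_iso_degrees_le[OF *, of D] by (simp add: xy)
qed

definition ball_graph :: "graph \<Rightarrow> nat set \<Rightarrow> nat \<Rightarrow> graph" where
  "ball_graph G S r =
     (let W = {v \<in> verts G. \<exists>s\<in>S. \<exists>k\<le>r. (s, v) \<in> edges G ^^ k}
      in \<lparr>verts = W, edges = edges G \<inter> W \<times> W\<rparr>)"

lemma graph_iso_relpow:
  assumes "graph_iso \<phi> G H" "conn_graph G" "v \<in> verts G" "(v, w) \<in> edges G ^^ k"
  shows "w \<in> verts G \<and> (\<phi> v, \<phi> w) \<in> edges H ^^ k"
  using assms(4)
proof (induction k arbitrary: w)
  case 0
  then show ?case using assms(3) by simp
next
  case (Suc k)
  then obtain u where u: "(v, u) \<in> edges G ^^ k" "(u, w) \<in> edges G" by auto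
  moreover have "u \<in> verts G" "w \<in> verts G"
    using u(2) assms(2) by (auto simp: conn_graph_def)
  ultimately show ?case
    using Suc.IH[OF u(1)] assms(1) by (auto simp: graph_iso_def)
qed

lemma graph_iso_ball_graph:
  assumes "graph_iso \<phi> G H" "conn_graph G" "conn_graph H" "S \<subseteq> verts G"
  shows "graph_iso \<phi> (ball_graph G S r) (ball_graph H (\<phi> ` S) r)"
proof -
  obtain \<psi> where \<psi>: "graph_iso \<psi> H G" "\<And>v. v \<in> verts G \<Longrightarrow> \<psi> (\<phi> v) = v"
    using graph_iso_sym[OF assms(1)] by blast
  have relpow: "(s, v) \<in> edges G ^^ k \<longleftrightarrow> (\<phi> s, \<phi> v) \<in> edges H ^^ k"
    if "s \<in> S" "v \<in> verts G" for s v k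
  proof -
    have "s \<in> verts G" using that assms(4) by auto
    then show ?thesis
      using graph_iso_relpow[OF assms(1,2), of s v k] \<psi> that
        graph_iso_relpow[OF \<psi>(1) assms(3), of "\<phi> s" "\<phi> v" k] graph_iso_in[OF assms(1)]
      by auto
  qed
  have bij: "inj_on \<phi> (verts G)" "\<phi> ` verts G = verts H"
    using assms(1) by (auto simp: graph_iso_def bij_betw_def)
  have W: "verts (ball_graph K T r) = {v \<in> verts K. \<exists>s\<in>T. \<exists>k\<le>r. (s, v) \<in> edges K ^^ k}" for K T
    by (simp add: ball_graph_def Let_def)
  have E: "edges (ball_graph K T r) = edges K \<inter> verts (ball_graph K T r) \<times> verts (ball_graph K T r)" for K T
    by (simp add: ball_graph_def Let_def)
  have mem: "\<phi> v \<in> verts (ball_graph H (\<phi> ` S) r) \<longleftrightarrow> v \<in> verts (ball_graph G S r)"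
    if "v \<in> verts G" for v
    using that relpow graph_iso_in[OF assms(1)] by (auto simp: W)
  have sub: "verts (ball_graph G S r) \<subseteq> verts G" "verts (ball_graph H (\<phi> ` S) r) \<subseteq> verts H"
    by (auto simp: W)
  have "\<phi> ` verts (ball_graph G S r) = verts (ball_graph H (\<phi> ` S) r)"
  proof
    show "\<phi> ` verts (ball_graph G S r) \<subseteq> verts (ball_graph H (\<phi> ` S) r)"
      using mem sub(1) by auto
    show "verts (ball_graph H (\<phi> ` S) r) \<subseteq> \<phi> ` verts (ball_graph G S r)"
    proof
      fix w assume w: "w \<in> verts (ball_graph H (\<phi> ` S) r)"
      then obtain v where "v \<in> verts G" "w = \<phi> v" using sub(2) bij(2) by blast
      then show "w \<in> \<phi> ` verts (ball_graph G S r)" using mem w by simp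
    qed
  qed
  then have "bij_betw \<phi> (verts (ball_graph G S r)) (verts (ball_graph H (\<phi> ` S) r))"
    using inj_on_subset[OF bij(1) sub(1)] by (simp add: bij_betw_def)
  moreover have "(v, w) \<in> edges (ball_graph G S r) \<longleftrightarrow>
      (\<phi> v, \<phi> w) \<in> edges (ball_graph H (\<phi> ` S) r)"
    if "v \<in> verts (ball_graph G S r)" "w \<in> verts (ball_graph G S r)" for v w
  proof -
    have "v \<in> verts G" "w \<in> verts G" using that sub by auto
    then show ?thesis
      unfolding E[of G] E[of H] using that mem assms(1) by (auto simp: graph_iso_def)
  qed
  ultimately show ?thesis by (simp add: graph_iso_def)
qed

lemma ball_graph_iso_transfer:
  assumes "graph_iso \<alpha> G G'" "conn_graph G" "conn_graph G'" "S \<subseteq> verts G"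
    and "graph_iso \<beta> H H'" "conn_graph H" "conn_graph H'" "T \<subseteq> verts H"
    and "graph_iso \<phi> (ball_graph G S r) (ball_graph H T r)"
  shows "\<exists>\<psi>. graph_iso \<psi> (ball_graph G' (\<alpha> ` S) r) (ball_graph H' (\<beta> ` T) r) \<and>
    (\<forall>s\<in>S. \<psi> (\<alpha> s) = \<beta> (\<phi> s))"
proof -
  obtain \<gamma> where \<gamma>: "graph_iso \<gamma> (ball_graph G' (\<alpha> ` S) r) (ball_graph G S r)"
      "\<And>v. v \<in> verts (ball_graph G S r) \<Longrightarrow> \<gamma> (\<alpha> v) = v"
    using graph_iso_sym[OF graph_iso_ball_graph[OF assms(1-4)]] by blast
  have "\<gamma> (\<alpha> s) = s" if "s \<in> S" for s
  proof -
    have "s \<in> verts (ball_graph G S r)"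
      using that assms(4)
      by (auto simp: ball_graph_def Let_def intro!: bexI[of _ s] exI[of _ "0::nat"])
    then show ?thesis by (rule \<gamma>(2))
  qed
  then show ?thesis
    using graph_iso_comp[OF graph_iso_comp[OF \<gamma>(1) assms(9)] graph_iso_ball_graph[OF assms(5-8), of r]]
    by auto
qed

lift_definition same_ball :: "nat \<Rightarrow> rooted_graph \<Rightarrow> rooted_graph \<Rightarrow> bool" is
  "\<lambda>r (G, a) (H, b). \<exists>\<phi>. graph_iso \<phi> (ball_graph G {a} r) (ball_graph H {b} r) \<and> \<phi> a = b"
proof -
  define R where "R = (\<lambda>r (G, a) (H, b).
    \<exists>\<phi>. graph_iso \<phi> (ball_graph G {a} r) (ball_graph H {b :: nat} r) \<and> \<phi> a = b)"
  have imp: "R r x' y'" if xy: "rooted_iso x x'" "rooted_iso y y'" and R: "R r x y" for r x x' y y'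
  proof -
    obtain G a G' a' H b H' b' where eq: "x = (G, a)" "x' = (G', a')" "y = (H, b)" "y' = (H', b')"
      by (cases x, cases x', cases y, cases y')
    from R obtain \<phi> where \<phi>: "graph_iso \<phi> (ball_graph G {a} r) (ball_graph H {b} r)" "\<phi> a = b"
      by (auto simp: R_def eq)
    from xy obtain \<alpha> \<beta> where "graph_iso \<alpha> G G'" "conn_graph G" "conn_graph G'" "{a} \<subseteq> verts G" "\<alpha> a = a'"
        "graph_iso \<beta> H H'" "conn_graph H" "conn_graph H'" "{b} \<subseteq> verts H" "\<beta> b = b'"
      by (auto simp: rooted_iso_def eq)
    with ball_graph_iso_transfer[of \<alpha> G G' "{a}" \<beta> H H' "{b}" \<phi> r] \<phi> show ?thesis
      by (auto simp: R_def eq)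
  qed
  have sym: "rooted_iso y x" if "rooted_iso x y" for x y
    using that rooted_graph_equivp by (auto dest: part_equivp_symp)
  fix r x x' y y'
  assume "rooted_iso x x'" "rooted_iso y y'"
  then have "R r x y = R r x' y'" using imp sym by blast
  then show "?thesis r x x' y y'" by (simp add: R_def)
qed

text \<open>For doubly rooted graphs, \<open>r\<close>-neighbourhoods of the pair of roots are compared.  Once
  \<open>r\<close> is at least the distance of the roots, these neighbourhoods lie between the balls of radius
  \<open>r\<close> and \<open>2 * r\<close> around the first root, so the resulting topology does not depend on this choice.\<close>

lift_definition doubly_same_ball :: "nat \<Rightarrow> doubly_rooted_graph \<Rightarrow> doubly_rooted_graph \<Rightarrow> bool" is
  "\<lambda>r (G, a, c) (H, b, d).
     \<exists>\<phi>. graph_iso \<phi> (ball_graph G {a, c} r) (ball_graph H {b, d} r) \<and> \<phi> a = b \<and> \<phi> c = d"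
proof -
  define R where "R = (\<lambda>r (G, a, c) (H, b, d).
    \<exists>\<phi>. graph_iso \<phi> (ball_graph G {a, c} r) (ball_graph H {b :: nat, d} r) \<and> \<phi> a = b \<and> \<phi> c = d)"
  have imp: "R r x' y'" if xy: "doubly_rooted_iso x x'" "doubly_rooted_iso y y'" and R: "R r x y" for r x x' y y'
  proof -
    obtain G a c G' a' c' H b d H' b' d' where eq: "x = (G, a, c)" "x' = (G', a', c')" "y = (H, b, d)" "y' = (H', b', d')"
      by (cases x, cases x', cases y, cases y')
    from R obtain \<phi> where \<phi>: "graph_iso \<phi> (ball_graph G {a, c} r) (ball_graph H {b, d} r)" "\<phi> a = b" "\<phi> c = d"
      by (auto simp: R_def eq)
    from xy obtain \<alpha> \<beta> where "graph_iso \<alpha> G G'" "conn_graph G" "conn_graph G'" "{a, c} \<subseteq> verts G" "\<alpha> a = a'" "\<alpha> c = c'"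
        "graph_iso \<beta> H H'" "conn_graph H" "conn_graph H'" "{b, d} \<subseteq> verts H" "\<beta> b = b'" "\<beta> d = d'"
      by (auto simp: doubly_rooted_iso_def eq)
    with ball_graph_iso_transfer[of \<alpha> G G' "{a, c}" \<beta> H H' "{b, d}" \<phi> r] \<phi> show ?thesis
      by (auto simp: R_def eq)
  qed
  have sym: "doubly_rooted_iso y x" if "doubly_rooted_iso x y" for x y
    using that doubly_rooted_graph_equivp by (auto dest: part_equivp_symp)
  fix r x x' y y'
  assume "doubly_rooted_iso x x'" "doubly_rooted_iso y y'"
  then have "R r x y = R r x' y'" using imp sym by blast
  then show "?thesis r x x' y y'" by (simp add: R_def)
qed

instantiation rooted_graph :: topological_space
begin

definition open_rooted_graph :: "rooted_graph set \<Rightarrow> bool" where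
  "open_rooted_graph = generate_topology {{y. same_ball r x y} | r x. True}"

instance
  by standard (auto simp: open_rooted_graph_def intro: generate_topology.intros)

end

instantiation doubly_rooted_graph :: topological_space
begin

definition open_doubly_rooted_graph :: "doubly_rooted_graph set \<Rightarrow> bool" where
  "open_doubly_rooted_graph = generate_topology {{y. doubly_same_ball r x y} | r x. True}"

instance
  by standard (auto simp: open_doubly_rooted_graph_def intro: generate_topology.intros)

end

definition rooted_space :: "nat \<Rightarrow> rooted_graph measure" where
  "rooted_space D = restrict_space borel {x. degrees_le D x}"

definition doubly_rooted_space :: "nat \<Rightarrow> doubly_rooted_graph measure" where
  "doubly_rooted_space D = restrict_space borel {z. doubly_degrees_le D z}"

text \<open>The sums \<open>\<Sum>b. f (G, a, b)\<close> and \<open>\<Sum>b. f (G, b, a)\<close> over all vertices \<open>b\<close> of \<open>G\<close>,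
  as functions of the class of \<open>(G, a)\<close>.\<close>

lift_definition mass_out :: "(doubly_rooted_graph \<Rightarrow> real) \<Rightarrow> rooted_graph \<Rightarrow> ennreal" is
  "\<lambda>f (G, a). \<Sum>\<^sub>\<infinity>b\<in>verts G. ennreal (f (abs_doubly_rooted_graph (G, a, b)))"
proof -
  fix f :: "doubly_rooted_graph \<Rightarrow> real" and x y
  assume "rooted_iso x y"
  then obtain G a H \<phi> where xy: "x = (G, a)" "y = (H, \<phi> a)" and conn: "conn_graph G" "conn_graph H"
    and a: "a \<in> verts G" and iso: "graph_iso \<phi> G H"
    by (auto simp: rooted_iso_def)
  have "abs_doubly_rooted_graph (G, a, b) = abs_doubly_rooted_graph (H, \<phi> a, \<phi> b)" if "b \<in> verts G" for b
    using that a iso conn graph_iso_in[OF iso]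
    by (intro Quotient3_rel_abs[OF Quotient3_doubly_rooted_graph]) (auto simp: doubly_rooted_iso_def)
  then have "(\<Sum>\<^sub>\<infinity>b\<in>verts G. ennreal (f (abs_doubly_rooted_graph (G, a, b)))) =
      (\<Sum>\<^sub>\<infinity>b\<in>verts G. ennreal (f (abs_doubly_rooted_graph (H, \<phi> a, \<phi> b))))"
    by (intro infsum_cong) simp
  also have "\<dots> = (\<Sum>\<^sub>\<infinity>b\<in>verts H. ennreal (f (abs_doubly_rooted_graph (H, \<phi> a, b))))"
    using iso by (intro infsum_reindex_bij_betw) (simp add: graph_iso_def)
  finally show "?thesis f x y" by (simp add: xy)
qed

lift_definition mass_in :: "(doubly_rooted_graph \<Rightarrow> real) \<Rightarrow> rooted_graph \<Rightarrow> ennreal" is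
  "\<lambda>f (G, a). \<Sum>\<^sub>\<infinity>b\<in>verts G. ennreal (f (abs_doubly_rooted_graph (G, b, a)))"
proof -
  fix f :: "doubly_rooted_graph \<Rightarrow> real" and x y
  assume "rooted_iso x y"
  then obtain G a H \<phi> where xy: "x = (G, a)" "y = (H, \<phi> a)" and conn: "conn_graph G" "conn_graph H"
    and a: "a \<in> verts G" and iso: "graph_iso \<phi> G H"
    by (auto simp: rooted_iso_def)
  have "abs_doubly_rooted_graph (G, b, a) = abs_doubly_rooted_graph (H, \<phi> b, \<phi> a)" if "b \<in> verts G" for b
    using that a iso conn graph_iso_in[OF iso]
    by (intro Quotient3_rel_abs[OF Quotient3_doubly_rooted_graph]) (auto simp: doubly_rooted_iso_def)
  then have "(\<Sum>\<^sub>\<infinity>b\<in>verts G. ennreal (f (abs_doubly_rooted_graph (G, b, a)))) =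
      (\<Sum>\<^sub>\<infinity>b\<in>verts G. ennreal (f (abs_doubly_rooted_graph (H, \<phi> b, \<phi> a))))"
    by (intro infsum_cong) simp
  also have "\<dots> = (\<Sum>\<^sub>\<infinity>b\<in>verts H. ennreal (f (abs_doubly_rooted_graph (H, b, \<phi> a))))"
    using iso by (intro infsum_reindex_bij_betw) (simp add: graph_iso_def)
  finally show "?thesis f x y" by (simp add: xy)
qed

definition unimodular :: "nat \<Rightarrow> rooted_graph measure \<Rightarrow> bool" where
  "unimodular D \<nu> \<longleftrightarrow> prob_space \<nu> \<and> sets \<nu> = sets (rooted_space D) \<and>
     (\<forall>f \<in> borel_measurable (doubly_rooted_space D).
        (\<forall>z \<in> space (doubly_rooted_space D). 0 \<le> f z) \<longrightarrow>
        (\<integral>\<^sup>+x. mass_in f x \<partial>\<nu>) = (\<integral>\<^sup>+x. mass_out f x \<partial>\<nu>))"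

definition rerooting_invariant :: "rooted_graph set \<Rightarrow> bool" where
  "rerooting_invariant U \<longleftrightarrow> (\<forall>G. conn_graph G \<longrightarrow>
     (\<forall>a\<in>verts G. \<forall>b\<in>verts G. abs_rooted_graph (G, a) \<in> U \<longrightarrow> abs_rooted_graph (G, b) \<in> U))"

definition ergodic :: "rooted_graph measure \<Rightarrow> bool" where
  "ergodic \<nu> \<longleftrightarrow> (\<forall>U \<in> sets \<nu>. rerooting_invariant U \<longrightarrow> measure \<nu> U \<in> {0, 1})"

text \<open>The law of the position at time \<open>n\<close> of the simple random walk on \<open>G\<close> started at \<open>a\<close>.\<close>

primrec srw :: "graph \<Rightarrow> nat \<Rightarrow> nat \<Rightarrow> nat pmf" where
  "srw G a 0 = return_pmf a"
| "srw G a (Suc n) = bind_pmf (srw G a n) (\<lambda>v. pmf_of_set (neighbours G v))"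

lemma set_pmf_srw:
  assumes "conn_graph G" "a \<in> verts G"
  shows "set_pmf (srw G a n) \<subseteq> verts G"
proof (induction n)
  case (Suc n)
  have "set_pmf (pmf_of_set (neighbours G v)) \<subseteq> verts G" if "v \<in> verts G" for v
    using assms(1) that by (subst set_pmf_of_set) (auto simp: conn_graph_def neighbours_def)
  then show ?case using Suc by fastforce
qed (use assms in simp)

lemma srw_graph_iso:
  assumes "graph_iso \<phi> G H" "conn_graph G" "conn_graph H" "a \<in> verts G"
  shows "srw H (\<phi> a) n = map_pmf \<phi> (srw G a n)"
proof (induction n)
  case (Suc n)
  have "map_pmf \<phi> (pmf_of_set (neighbours G v)) = pmf_of_set (neighbours H (\<phi> v))"
    if "v \<in> set_pmf (srw G a n)" for v
  proof -
    have v: "v \<in> verts G" using set_pmf_srw[OF assms(2,4)] that by blast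
    then show ?thesis
      using assms(2) graph_iso_neighbours[OF assms(1-3) v]
      by (intro map_pmf_of_set_bij_betw) (auto simp: conn_graph_def)
  qed
  then have "bind_pmf (srw G a n) (\<lambda>v. pmf_of_set (neighbours H (\<phi> v))) =
      bind_pmf (srw G a n) (\<lambda>v. map_pmf \<phi> (pmf_of_set (neighbours G v)))"
    by (intro bind_pmf_cong) simp_all
  then show ?case by (simp add: Suc bind_map_pmf map_bind_pmf)
qed simp

lift_definition return_prob :: "nat \<Rightarrow> rooted_graph \<Rightarrow> real" is
  "\<lambda>n (G, a). pmf (srw G a n) a"
proof -
  fix n x y
  assume "rooted_iso x y"
  then obtain G a H \<phi> where xy: "x = (G, a)" "y = (H, \<phi> a)" and conn: "conn_graph G" "conn_graph H"
    and a: "a \<in> verts G" and iso: "graph_iso \<phi> G H"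
    by (auto simp: rooted_iso_def)
  have "pmf (srw H (\<phi> a) n) (\<phi> a) = measure (srw G a n) (\<phi> -` {\<phi> a})"
    by (simp add: srw_graph_iso[OF iso conn a] pmf_map)
  also have "\<dots> = measure (srw G a n) {a}"
    using set_pmf_srw[OF conn(1) a, of n] iso a
    by (intro measure_pmf.finite_measure_eq_AE)
       (auto simp: AE_measure_pmf_iff graph_iso_def bij_betw_def inj_on_def)
  finally show "?thesis n x y" by (simp add: xy measure_pmf_single)
qed

definition quenched_radius :: "rooted_graph \<Rightarrow> real" where
  "quenched_radius x = lim (\<lambda>n. root (2 * n) (return_prob (2 * n) x))"

definition annealed_radius :: "rooted_graph measure \<Rightarrow> real" where
  "annealed_radius \<nu> = lim (\<lambda>n. root (2 * n) (\<integral>x. return_prob (2 * n) x \<partial>\<nu>))"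

end

theory Submission
  imports Defs
begin

text \<open>Write \<open>p\<^sub>k\<close> for the probability of return to the root at time \<open>k\<close>.  The key to the theorem
  is that the quenched radius bounds return probabilities at all finite times, with constant one:
  \<open>p\<^sub>2\<^sub>n\<close> is supermultiplicative in \<open>n\<close>, since two closed walks can be concatenated, so by Fekete's
  argument its roots converge to their supremum and \<open>p\<^sub>2\<^sub>n \<le> \<rho>\<^sub>q ^ (2 * n)\<close> on every rooted graph
  (\<open>supermultiplicative_root_convergent\<close>, \<open>root_return_prob_le\<close>).

  Let \<open>E\<close> be the essential supremum of \<open>\<rho>\<^sub>q\<close>.  Integrating this bound shows that the roots
  of the expected return probabilities are at most \<open>E\<close>.  Conversely, if \<open>c < E\<close>, then with positive
  probability \<open>\<rho>\<^sub>q > c\<close>, hence \<open>p\<^sub>2\<^sub>n \<ge> c ^ (2 * n)\<close> from some random time on.  By countable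
  additivity a single deterministic time serves on an event of some probability \<open>\<delta> > 0\<close>.  The
  expectation is then at least \<open>\<delta> * c ^ (2 * n)\<close>, and the factor \<open>\<delta>\<close> disappears under the root
  (\<open>root_expectation_tendsto_esssup\<close>).

  The random variables involved are measurable because \<open>p\<^sub>n\<close> depends only on the ball of radius
  \<open>n\<close> around the root and so is locally constant (\<open>continuous_return_prob\<close>).  In the ergodic case,
  \<open>\<rho>\<^sub>q\<close> is unchanged by rerooting (\<open>quenched_radius_le_reroot\<close>), so each event \<open>\<rho>\<^sub>q \<le> c\<close> has
  probability zero or one; for \<open>c < E\<close> it does not have probability one, and therefore
  \<open>\<rho>\<^sub>q \<ge> E\<close> almost surely.\<close>

section \<open>Supermultiplicative sequences\<close>

text \<open>This is Fekete's lemma in multiplicative form.  Writing \<open>n = m * q + r\<close> with \<open>r < m\<close>,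
  supermultiplicativity gives \<open>u n \<ge> u m ^ q * u r\<close>.  The finitely many remainders contribute at
  least a positive constant, which \<open>n\<close>-th roots send to one, so eventually no root is much smaller
  than the \<open>m\<close>-th; hence the limit is the supremum.\<close>

lemma supermultiplicative_root_convergent:
  fixes u :: "nat \<Rightarrow> real"
  assumes super: "\<And>m n. u m * u n \<le> u (m + n)"
    and pos: "\<And>n. 0 < u n" and le_1: "\<And>n. u n \<le> 1"
  obtains L where "(\<lambda>n. root n (u n)) \<longlonglongrightarrow> L" "\<And>n. 0 < n \<Longrightarrow> root n (u n) \<le> L"
proof -
  define S where "S = (\<lambda>n. root n (u n)) ` {0<..}"
  have bdd: "bdd_above S"
    using le_1 by (intro bdd_aboveI[of _ 1]) (auto simp: S_def)
  have upper: "root n (u n) \<le> Sup S" if "0 < n" for n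
    using that bdd by (auto simp: S_def intro: cSup_upper)
  have "(\<lambda>n. root n (u n)) \<longlonglongrightarrow> Sup S"
  proof (rule order_tendstoI)
    fix b assume "Sup S < b"
    then show "\<forall>\<^sub>F n in sequentially. root n (u n) < b"
      by (intro eventually_sequentiallyI[of 1]) (simp add: order.strict_trans1[OF upper])
  next
    fix b assume "b < Sup S"
    moreover have "S \<noteq> {}" by (auto simp: S_def)
    ultimately obtain m where m: "0 < m" "b < root m (u m)"
      using less_cSup_iff[OF _ bdd] by (auto simp: S_def)
    define l where "l = root m (u m)"
    have l: "0 < l" "l \<le> 1" "l ^ m = u m"
      using m(1) pos[of m] le_1[of m] by (auto simp: l_def)
    define c where "c = Min (u ` {..<m})"
    have c: "0 < c" "\<And>r. r < m \<Longrightarrow> c \<le> u r"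
      using m(1) pos by (auto simp: c_def lessThan_empty_iff)
    have iterate: "u m ^ q * u r \<le> u (m * q + r)" for q r
    proof (induction q)
      case (Suc q)
      have "u m ^ Suc q * u r \<le> u m * u (m * q + r)"
        using Suc pos[of m] by (simp add: mult.assoc)
      also have "\<dots> \<le> u (m + (m * q + r))" by (rule super)
      finally show ?case by (simp add: algebra_simps)
    qed simp
    \<comment> \<open>As \<open>l \<le> 1\<close>, replacing the exponent \<open>m * (n div m)\<close> by \<open>n\<close> only decreases the bound.\<close>
    have lower: "l ^ n * c \<le> u n" for n
    proof -
      have "l ^ n * c \<le> l ^ (m * (n div m)) * u (n mod m)"
        using l m(1) pos c(2)[of "n mod m"] c(1)
        by (intro mult_mono power_decreasing) auto
      also have "\<dots> = u m ^ (n div m) * u (n mod m)"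
        by (simp add: power_mult l(3))
      also have "\<dots> \<le> u (m * (n div m) + n mod m)" by (rule iterate)
      finally show ?thesis by simp
    qed
    have "(\<lambda>n. l * root n c) \<longlonglongrightarrow> l * 1"
      by (intro tendsto_intros LIMSEQ_root_const c)
    moreover have "b < l * 1" using m(2) by (simp add: l_def)
    ultimately have "\<forall>\<^sub>F n in sequentially. b < l * root n c"
      by (rule order_tendstoD(1))
    moreover have "\<forall>\<^sub>F n in sequentially. l * root n c \<le> root n (u n)"
    proof (rule eventually_sequentiallyI[of 1])
      fix n :: nat assume "1 \<le> n"
      then have "root n (l ^ n * c) \<le> root n (u n)"
        using lower[of n] by simp
      then show "l * root n c \<le> root n (u n)"
        using \<open>1 \<le> n\<close> l(1) by (simp add: real_root_mult real_root_power_cancel)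
    qed
    ultimately show "\<forall>\<^sub>F n in sequentially. b < root n (u n)"
      by eventually_elim simp
  qed
  then show ?thesis using upper by (rule that)
qed

section \<open>Moments and the essential supremum\<close>

text \<open>A variant of the convergence of \<open>L\<^sup>p\<close> norms to the \<open>L\<^sup>\<infinity>\<close> norm, which is the case
  \<open>f n = r ^ k n\<close>.  The upper estimate comes from the bound of the roots by their limit \<open>r\<close>, the
  lower one from their pointwise convergence.\<close>

lemma root_expectation_tendsto_esssup:
  fixes f :: "nat \<Rightarrow> 'a \<Rightarrow> real" and r :: "'a \<Rightarrow> real"
  assumes "prob_space M"
    and meas [measurable]: "\<And>n. f n \<in> borel_measurable M"
    and k: "filterlim k at_top sequentially"
    and nonneg: "\<And>n x. x \<in> space M \<Longrightarrow> 0 \<le> f n x"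
    and le_1: "\<And>n x. x \<in> space M \<Longrightarrow> f n x \<le> 1"
    and lim: "\<And>x. x \<in> space M \<Longrightarrow> (\<lambda>n. root (k n) (f n x)) \<longlonglongrightarrow> r x"
    and le_r: "\<And>n x. x \<in> space M \<Longrightarrow> 0 < k n \<Longrightarrow> root (k n) (f n x) \<le> r x"
  obtains L where "(\<lambda>n. root (k n) (\<integral>x. f n x \<partial>M)) \<longlonglongrightarrow> L"
    and "ereal L = esssup M (\<lambda>x. ereal (r x))"
proof -
  interpret prob_space M by fact
  have k_pos: "\<forall>\<^sub>F n in sequentially. 0 < k n"
    using eventually_compose_filterlim[OF eventually_gt_at_top[of 0] k] .
  have int: "integrable M (f n)" for n
    using nonneg le_1 by (intro integrable_const_bound[of _ 1]) (auto intro!: AE_I2)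
  have root_01: "0 \<le> root (k n) (f n x) \<and> root (k n) (f n x) \<le> 1" if "x \<in> space M" for n x
    using nonneg[OF that, of n] le_1[OF that, of n] by (cases "k n = 0") auto
  have r_01: "0 \<le> r x" "r x \<le> 1" if "x \<in> space M" for x
    using root_01[OF that] lim[OF that]
    by (auto intro: LIMSEQ_le_const LIMSEQ_le_const2)
  have [measurable]: "r \<in> borel_measurable M"
    using lim by (rule borel_measurable_LIMSEQ_real) measurable
  define E where "E = esssup M (\<lambda>x. ereal (r x))"
  have "E \<le> 1"
    unfolding E_def using r_01 by (intro esssup_I AE_I2) auto
  moreover have AE_le_E: "AE x in M. ereal (r x) \<le> E"
    unfolding E_def by (rule esssup_AE)
  have "AE x in M. 0 \<le> E"
    using AE_le_E AE_space
    by eventually_elim (metis r_01(1) ereal_less_eq(5) order_trans)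
  then have "0 \<le> E" by simp
  ultimately obtain L where L: "E = ereal L" "0 \<le> L"
    by (cases E) auto
  have AE_le: "AE x in M. r x \<le> L"
    using AE_le_E L by simp
  have upper: "root (k n) (\<integral>x. f n x \<partial>M) \<le> L" if "0 < k n" for n
  proof -
    have "(\<integral>x. f n x \<partial>M) \<le> (\<integral>x. L ^ k n \<partial>M)"
    proof (rule integral_mono_AE)
      show "AE x in M. f n x \<le> L ^ k n"
        using AE_le AE_space
      proof eventually_elim
        case (elim x)
        have "f n x = root (k n) (f n x) ^ k n"
          using that nonneg elim by simp
        also have "\<dots> \<le> L ^ k n"
          using that nonneg elim le_r[of x n] by (intro power_mono) auto
        finally show ?case .
      qed
    qed (use int in auto)
    then have "root (k n) (\<integral>x. f n x \<partial>M) \<le> root (k n) (L ^ k n)"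
      using that by (simp add: prob_space)
    then show ?thesis
      using that L(2) by (simp add: real_root_power_cancel)
  qed
  have "(\<lambda>n. root (k n) (\<integral>x. f n x \<partial>M)) \<longlonglongrightarrow> L"
  proof (rule order_tendstoI)
    fix b assume "L < b"
    show "\<forall>\<^sub>F n in sequentially. root (k n) (\<integral>x. f n x \<partial>M) < b"
      using k_pos by eventually_elim (use upper \<open>L < b\<close> in \<open>auto intro: le_less_trans\<close>)
  next
    fix b assume "b < L"
    show "\<forall>\<^sub>F n in sequentially. b < root (k n) (\<integral>x. f n x \<partial>M)"
    \<comment> \<open>Powers of \<open>c\<close> are compared below, so \<open>b\<close> has to be nonnegative to find \<open>c > 0\<close>.\<close>
    proof (cases "b < 0")
      case True
      have "0 \<le> root (k n) (\<integral>x. f n x \<partial>M)" for n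
        using nonneg by (cases "k n = 0") (auto intro!: integral_nonneg_AE AE_I2)
      with True show ?thesis by (intro always_eventually allI) (rule less_le_trans)
    next
      case False
      obtain c where c: "b < c" "c < L" using dense[OF \<open>b < L\<close>] by blast
      with False have "0 < c" by simp
      define A where "A N = {x \<in> space M. \<forall>n\<ge>N. c \<le> root (k n) (f n x)}" for N
      have [measurable]: "A N \<in> sets M" for N
        unfolding A_def by measurable
      \<comment> \<open>The sets \<open>A N\<close> cover \<open>{x. c < r x}\<close>, which is not a null set since \<open>c < L\<close>.\<close>
      have "\<exists>N. measure M (A N) \<noteq> 0"
      proof (rule ccontr)
        assume "\<not> ?thesis"
        then have null: "A N \<in> null_sets M" for N
          by (auto simp: null_sets_def emeasure_eq_measure)
        have "AE x in M. \<forall>N. x \<notin> A N"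
          unfolding AE_all_countable by (intro allI AE_not_in null)
        then have "AE x in M. r x \<le> c"
          using AE_space
        proof eventually_elim
          case (elim x)
          show ?case
          proof (rule ccontr)
            assume "\<not> r x \<le> c"
            then have "\<forall>\<^sub>F n in sequentially. c < root (k n) (f n x)"
              using lim[OF elim(2)] by (intro order_tendstoD(1)) auto
            then obtain N where "\<And>n. N \<le> n \<Longrightarrow> c < root (k n) (f n x)"
              by (auto simp: eventually_sequentially)
            then have "x \<in> A N" using elim(2) by (auto simp: A_def intro: less_imp_le)
            with elim(1) show False by blast
          qed
        qed
        then have "E \<le> ereal c"
          unfolding E_def by (intro esssup_I) auto
        with L(1) c(2) show False by simp
      qed
      then obtain N where N: "0 < measure M (A N)"
        by (auto simp: less_le)
      define \<delta> where "\<delta> = measure M (A N)"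
      have lower: "c * root (k n) \<delta> \<le> root (k n) (\<integral>x. f n x \<partial>M)" if "N \<le> n" "0 < k n" for n
      proof -
        have "c ^ k n * \<delta> = (\<integral>x. c ^ k n * indicator (A N) x \<partial>M)"
          by (simp add: \<delta>_def)
        also have "\<dots> \<le> (\<integral>x. f n x \<partial>M)"
        proof (rule integral_mono)
          fix x assume x: "x \<in> space M"
          show "c ^ k n * indicator (A N) x \<le> f n x"
          proof (cases "x \<in> A N")
            case True
            then have "c ^ k n \<le> root (k n) (f n x) ^ k n"
              using that \<open>0 < c\<close> by (intro power_mono) (auto simp: A_def)
            then show ?thesis using True that nonneg[OF x] by simp
          qed (use nonneg[OF x] in simp)
        qed (use int in \<open>auto simp: emeasure_eq_measure\<close>)
        finally have "root (k n) (c ^ k n * \<delta>) \<le> root (k n) (\<integral>x. f n x \<partial>M)"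
          using that by simp
        then show ?thesis
          using that \<open>0 < c\<close> by (simp add: real_root_mult real_root_power_cancel)
      qed
      have "(\<lambda>n. c * root (k n) \<delta>) \<longlonglongrightarrow> c * 1"
        using N unfolding \<delta>_def
        by (intro tendsto_intros filterlim_compose[OF LIMSEQ_root_const k])
      then have "\<forall>\<^sub>F n in sequentially. b < c * root (k n) \<delta>"
        by (rule order_tendstoD(1)) (simp add: c)
      then show ?thesis
        using k_pos eventually_ge_at_top[of N]
        by eventually_elim (use lower in \<open>auto intro: less_le_trans\<close>)
    qed
  qed
  with L(1) show ?thesis by (intro that) (auto simp: E_def)
qed

section \<open>Transition probabilities of the simple random walk\<close>

lemma pmf_bind_ge: "pmf p b * pmf (q b) c \<le> pmf (bind_pmf p q) c"
proof -
  have "pmf p b * pmf (q b) c = (\<integral>x. indicator {b} x * pmf (q b) c \<partial>measure_pmf p)"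
    by (simp add: measure_pmf_single)
  also have "\<dots> \<le> (\<integral>x. pmf (q x) c \<partial>measure_pmf p)"
    by (intro integral_mono measure_pmf.integrable_const_bound[of _ 1])
       (auto simp: indicator_def pmf_le_1)
  finally show ?thesis by (simp add: pmf_bind)
qed

lemma srw_add: "srw G a (m + n) = bind_pmf (srw G a m) (\<lambda>v. srw G v n)"
  by (induction n) (simp_all add: bind_return_pmf' bind_assoc_pmf)

lemma srw_compose_ge: "pmf (srw G a m) b * pmf (srw G b n) c \<le> pmf (srw G a (m + n)) c"
  unfolding srw_add by (rule pmf_bind_ge)

lemma srw_pos_if_relpow:
  assumes "conn_graph G" "(a, b) \<in> edges G ^^ n"
  shows "0 < pmf (srw G a n) b"
  using assms(2)
proof (induction n arbitrary: b)
  case (Suc n)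
  then obtain v where v: "(a, v) \<in> edges G ^^ n" "(v, b) \<in> edges G" by auto
  then have "v \<in> verts G" using assms(1) by (auto simp: conn_graph_def)
  then have "finite (neighbours G v)" "neighbours G v \<noteq> {}" "b \<in> neighbours G v"
    using assms(1) v(2) by (auto simp: conn_graph_def neighbours_def)
  then have "0 < pmf (pmf_of_set (neighbours G v)) b"
    by (simp add: card_gt_0_iff)
  then have "0 < pmf (srw G a n) v * pmf (pmf_of_set (neighbours G v)) b"
    using Suc.IH[OF v(1)] by simp
  also have "\<dots> \<le> pmf (srw G a (Suc n)) b"
    unfolding srw.simps by (rule pmf_bind_ge)
  finally show ?case .
qed simp

lemma relpow_sym:
  assumes "sym R" "(a, b) \<in> R ^^ n"
  shows "(b, a) \<in> R ^^ n"
  using assms(2)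
proof (induction n arbitrary: b)
  case (Suc n)
  then obtain v where "(a, v) \<in> R ^^ n" "(v, b) \<in> R" by auto
  then have "(b, v) \<in> R" "(v, a) \<in> R ^^ n"
    using Suc.IH assms(1) by (auto dest: symD)
  then show ?case by (rule relpow_Suc_I2)
qed simp

text \<open>There are no isolated vertices, so the walk can go back and forth along one edge at the root.
  Odd return probabilities may vanish, as on bipartite graphs.\<close>

lemma srw_even_return_pos:
  assumes "conn_graph G" "a \<in> verts G"
  shows "0 < pmf (srw G a (2 * n)) a"
proof -
  obtain b where "(a, b) \<in> edges G" "(b, a) \<in> edges G"
    using assms by (fastforce simp: conn_graph_def neighbours_def sym_def)
  then have loop: "(a, a) \<in> edges G ^^ 2"
    by (auto simp: numeral_2_eq_2)
  have "(a, a) \<in> edges G ^^ (2 * n)"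
  proof (induction n)
    case (Suc n)
    then have "(a, a) \<in> edges G ^^ (2 * n) O edges G ^^ 2"
      using loop by (rule relcompI)
    then have "(a, a) \<in> edges G ^^ (2 * n + 2)"
      by (simp only: relpow_add)
    then show ?case by (simp only: mult_Suc_right add.commute)
  qed simp
  then show ?thesis by (rule srw_pos_if_relpow[OF assms(1)])
qed

section \<open>Return probabilities are local\<close>

lemma verts_ball_graph: "verts (ball_graph G {a} r) = {v \<in> verts G. \<exists>k\<le>r. (a, v) \<in> edges G ^^ k}"
  by (simp add: ball_graph_def Let_def)

lemma edges_ball_graph:
  "edges (ball_graph G {a} r) =
     edges G \<inter> verts (ball_graph G {a} r) \<times> verts (ball_graph G {a} r)"
  by (simp add: ball_graph_def Let_def)

text \<open>An isomorphism of balls respects only edges between vertices of the balls.  It still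
  transports walks of length at most \<open>r\<close> from the root, since these never leave
  the ball.\<close>

lemma ball_iso_relpow:
  assumes G: "conn_graph G" "a \<in> verts G" and H: "conn_graph H" "\<phi> a \<in> verts H"
    and iso: "graph_iso \<phi> (ball_graph G {a} r) (ball_graph H {\<phi> a} r)"
    and "(a, v) \<in> edges G ^^ k" "k \<le> r"
  shows "v \<in> verts (ball_graph G {a} r)" "(\<phi> a, \<phi> v) \<in> edges H ^^ k"
proof -
  have "v \<in> verts (ball_graph G {a} r) \<and> (\<phi> a, \<phi> v) \<in> edges H ^^ k"
    using assms(6,7)
  proof (induction k arbitrary: v)
    case 0
    then show ?case using G by (auto simp: verts_ball_graph)
  next
    case (Suc k)
    then obtain u where u: "(a, u) \<in> edges G ^^ k" "(u, v) \<in> edges G" by auto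
    have "v \<in> verts G" using u(2) G(1) by (auto simp: conn_graph_def)
    then have v: "v \<in> verts (ball_graph G {a} r)"
      using Suc.prems by (auto simp: verts_ball_graph simp del: relpow.simps)
    have *: "u \<in> verts (ball_graph G {a} r)" "(\<phi> a, \<phi> u) \<in> edges H ^^ k"
      using Suc.IH[OF u(1)] Suc.prems(2) by auto
    have "(u, v) \<in> edges (ball_graph G {a} r)"
      using u(2) v * by (subst edges_ball_graph) auto
    then have "(\<phi> u, \<phi> v) \<in> edges (ball_graph H {\<phi> a} r)"
      using iso v * by (auto simp: graph_iso_def)
    then have "(\<phi> u, \<phi> v) \<in> edges H"
      by (subst (asm) edges_ball_graph) auto
    with * v show ?case by auto
  qed
  then show "v \<in> verts (ball_graph G {a} r)" "(\<phi> a, \<phi> v) \<in> edges H ^^ k" by auto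
qed

text \<open>A vertex reached in fewer than \<open>r\<close> steps has all its neighbours in the ball, on both sides.
  The strict inequality matters: vertices at distance \<open>r\<close> may have neighbours outside.\<close>

lemma ball_iso_neighbours:
  assumes G: "conn_graph G" "a \<in> verts G" and H: "conn_graph H" "\<phi> a \<in> verts H"
    and iso: "graph_iso \<phi> (ball_graph G {a} r) (ball_graph H {\<phi> a} r)"
    and v: "(a, v) \<in> edges G ^^ k" "k < r"
  shows "bij_betw \<phi> (neighbours G v) (neighbours H (\<phi> v))"
proof -
  have bij: "bij_betw \<phi> (verts (ball_graph G {a} r)) (verts (ball_graph H {\<phi> a} r))"
    using iso by (simp add: graph_iso_def)
  have v_in: "v \<in> verts (ball_graph G {a} r)" and \<phi>v: "(\<phi> a, \<phi> v) \<in> edges H ^^ k"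
    using ball_iso_relpow[OF G H iso v(1)] v(2) by auto
  have \<phi>v_in: "\<phi> v \<in> verts (ball_graph H {\<phi> a} r)"
    using bij v_in by (auto simp: bij_betw_def)
  have nG: "neighbours G v \<subseteq> verts (ball_graph G {a} r)"
  proof
    fix w assume "w \<in> neighbours G v"
    then have "(a, w) \<in> edges G ^^ Suc k" using v(1) by (auto simp: neighbours_def)
    then show "w \<in> verts (ball_graph G {a} r)"
      using ball_iso_relpow(1)[OF G H iso] v(2) by (meson Suc_leI)
  qed
  have nH: "neighbours H (\<phi> v) \<subseteq> verts (ball_graph H {\<phi> a} r)"
  proof
    fix w assume w: "w \<in> neighbours H (\<phi> v)"
    then have "(\<phi> a, w) \<in> edges H ^^ Suc k" using \<phi>v by (auto simp: neighbours_def)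
    moreover have "w \<in> verts H" using w H(1) by (auto simp: neighbours_def conn_graph_def)
    ultimately show "w \<in> verts (ball_graph H {\<phi> a} r)"
      using Suc_leI[OF v(2)] by (auto simp: verts_ball_graph simp del: relpow.simps)
  qed
  have edge: "(v, w) \<in> edges G \<longleftrightarrow> (\<phi> v, \<phi> w) \<in> edges H"
    if w: "w \<in> verts (ball_graph G {a} r)" for w
  proof -
    have "\<phi> w \<in> verts (ball_graph H {\<phi> a} r)"
      using bij w by (auto simp: bij_betw_def)
    moreover have "(v, w) \<in> edges (ball_graph G {a} r) \<longleftrightarrow>
        (\<phi> v, \<phi> w) \<in> edges (ball_graph H {\<phi> a} r)"
      using iso v_in w by (auto simp: graph_iso_def)
    ultimately show ?thesis
      unfolding edges_ball_graph[of G] edges_ball_graph[of H] using v_in w \<phi>v_in by simp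
  qed
  have "\<phi> ` neighbours G v = neighbours H (\<phi> v)"
  proof
    show "\<phi> ` neighbours G v \<subseteq> neighbours H (\<phi> v)"
      using edge nG by (auto simp: neighbours_def)
    show "neighbours H (\<phi> v) \<subseteq> \<phi> ` neighbours G v"
    proof
      fix w assume w: "w \<in> neighbours H (\<phi> v)"
      then obtain u where u: "u \<in> verts (ball_graph G {a} r)" "w = \<phi> u"
        using nH bij by (auto simp: bij_betw_def)
      then show "w \<in> \<phi> ` neighbours G v"
        using w edge[OF u(1)] by (auto simp: neighbours_def)
    qed
  qed
  moreover have "inj_on \<phi> (neighbours G v)"
    using bij nG by (auto simp: bij_betw_def intro: inj_on_subset)
  ultimately show ?thesis by (simp add: bij_betw_def)
qed

lemma relpow_if_srw_pos:
  assumes "conn_graph G" "a \<in> verts G" "v \<in> set_pmf (srw G a n)"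
  shows "(a, v) \<in> edges G ^^ n"
  using assms(3)
proof (induction n arbitrary: v)
  case (Suc n)
  then obtain u where u: "u \<in> set_pmf (srw G a n)" "v \<in> set_pmf (pmf_of_set (neighbours G u))"
    by auto
  have "u \<in> verts G" using u(1) set_pmf_srw[OF assms(1,2)] by blast
  then have "v \<in> neighbours G u"
    using u(2) assms(1) by (auto simp: conn_graph_def)
  with Suc.IH[OF u(1)] show ?case by (auto simp: neighbours_def)
qed simp

text \<open>The first \<open>n\<close> steps of the walk choose neighbours only of vertices reached in fewer than
  \<open>n\<close> steps, so the law at time \<open>n\<close> is determined by the ball of radius \<open>n\<close>.\<close>

lemma srw_ball_iso:
  assumes G: "conn_graph G" "a \<in> verts G" and H: "conn_graph H" "\<phi> a \<in> verts H"
    and iso: "graph_iso \<phi> (ball_graph G {a} r) (ball_graph H {\<phi> a} r)" and "n \<le> r"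
  shows "srw H (\<phi> a) n = map_pmf \<phi> (srw G a n)"
  using \<open>n \<le> r\<close>
proof (induction n)
  case (Suc n)
  have "map_pmf \<phi> (pmf_of_set (neighbours G v)) = pmf_of_set (neighbours H (\<phi> v))"
    if v: "v \<in> set_pmf (srw G a n)" for v
  proof -
    have "v \<in> verts G" using set_pmf_srw[OF G] v by blast
    then show ?thesis
      using G(1) ball_iso_neighbours[OF G H iso relpow_if_srw_pos[OF G v]] Suc.prems
      by (intro map_pmf_of_set_bij_betw) (auto simp: conn_graph_def)
  qed
  then have "bind_pmf (srw G a n) (\<lambda>v. pmf_of_set (neighbours H (\<phi> v))) =
      bind_pmf (srw G a n) (\<lambda>v. map_pmf \<phi> (pmf_of_set (neighbours G v)))"
    by (intro bind_pmf_cong) simp_all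
  then show ?case using Suc by (simp add: bind_map_pmf map_bind_pmf)
qed simp

lemma srw_return_ball_iso:
  assumes G: "conn_graph G" "a \<in> verts G" and H: "conn_graph H" "\<phi> a \<in> verts H"
    and iso: "graph_iso \<phi> (ball_graph G {a} n) (ball_graph H {\<phi> a} n)"
  shows "pmf (srw H (\<phi> a) n) (\<phi> a) = pmf (srw G a n) a"
proof -
  have "inj_on \<phi> (verts (ball_graph G {a} n))"
    using iso by (simp add: graph_iso_def bij_betw_def)
  moreover have "set_pmf (srw G a n) \<subseteq> verts (ball_graph G {a} n)"
    using relpow_if_srw_pos[OF G] ball_iso_relpow(1)[OF G H iso] by blast
  moreover have "a \<in> verts (ball_graph G {a} n)"
    using ball_iso_relpow(1)[OF G H iso, of a 0] by simp
  ultimately have "measure (srw G a n) (\<phi> -` {\<phi> a}) = measure (srw G a n) {a}"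
    by (intro measure_pmf.finite_measure_eq_AE) (auto simp: AE_measure_pmf_iff inj_on_def)
  then show ?thesis
    by (simp add: srw_ball_iso[OF G H iso order_refl] pmf_map measure_pmf_single)
qed

lemma rooted_graph_cases:
  obtains G a where "x = abs_rooted_graph (G, a)" "conn_graph G" "a \<in> verts G"
proof -
  obtain G a where "rooted_iso (G, a) (G, a)" "x = abs_rooted_graph (G, a)"
    by (metis Quotient3_rooted_graph Quotient3_abs_rep Quotient3_rep_reflp surj_pair)
  then show ?thesis by (intro that) (auto simp: rooted_iso_def)
qed

lemma rooted_iso_refl: "conn_graph G \<Longrightarrow> a \<in> verts G \<Longrightarrow> rooted_iso (G, a) (G, a)"
  using graph_iso_id[of G] by (auto simp: rooted_iso_def)

lemma return_prob_abs:
  "conn_graph G \<Longrightarrow> a \<in> verts G \<Longrightarrow> return_prob n (abs_rooted_graph (G, a)) = pmf (srw G a n) a"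
  using return_prob.abs_eq[OF rooted_iso_refl] by simp

lemma return_prob_same_ball:
  assumes "same_ball n x y"
  shows "return_prob n y = return_prob n x"
proof -
  obtain G a where x: "x = abs_rooted_graph (G, a)" "conn_graph G" "a \<in> verts G"
    by (rule rooted_graph_cases)
  obtain H b where y: "y = abs_rooted_graph (H, b)" "conn_graph H" "b \<in> verts H"
    by (rule rooted_graph_cases)
  obtain \<phi> where "graph_iso \<phi> (ball_graph G {a} n) (ball_graph H {b} n)" "\<phi> a = b"
    using assms same_ball.abs_eq[OF rooted_iso_refl[OF x(2,3)] rooted_iso_refl[OF y(2,3)]]
    by (auto simp: x(1) y(1))
  then show ?thesis
    using srw_return_ball_iso[of G a H \<phi> n] x y by (simp add: return_prob_abs)
qed

lemma same_ball_refl: "same_ball n x x"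
proof -
  obtain G a where x: "x = abs_rooted_graph (G, a)" "conn_graph G" "a \<in> verts G"
    by (rule rooted_graph_cases)
  show ?thesis
    unfolding x(1) same_ball.abs_eq[OF rooted_iso_refl[OF x(2,3)] rooted_iso_refl[OF x(2,3)]]
    using graph_iso_id by auto
qed

text \<open>Return probabilities are locally constant: the preimage of any set is a union of basic
  open sets \<open>{y. same_ball n x y}\<close>.\<close>

lemma continuous_return_prob: "continuous_on UNIV (return_prob n)"
  unfolding continuous_on_open_vimage[OF open_UNIV]
proof (intro allI impI)
  fix B :: "real set" assume "open B"
  have "return_prob n -` B = (\<Union>x\<in>return_prob n -` B. {y. same_ball n x y})"
    using same_ball_refl return_prob_same_ball by auto
  moreover have "open {y. same_ball n x y}" for x
    unfolding open_rooted_graph_def by (rule generate_topology.Basis) auto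
  ultimately show "open (return_prob n -` B \<inter> UNIV)"
    by (metis (no_types, lifting) open_UN inf_top_right)
qed

section \<open>The quenched spectral radius\<close>

lemma
  shows return_prob_even_pos: "0 < return_prob (2 * n) x"
    and return_prob_le_1: "return_prob m x \<le> 1"
    and return_prob_supermult: "return_prob m x * return_prob m' x \<le> return_prob (m + m') x"
  by (rule rooted_graph_cases[of x];
      simp add: return_prob_abs srw_even_return_pos srw_compose_ge pmf_le_1)+

lemma
  shows root_return_prob_tendsto:
      "(\<lambda>n. root (2 * n) (return_prob (2 * n) x)) \<longlonglongrightarrow> quenched_radius x"
    and root_return_prob_le: "0 < n \<Longrightarrow> root (2 * n) (return_prob (2 * n) x) \<le> quenched_radius x"
proof -
  obtain L where L: "(\<lambda>n. root n (return_prob (2 * n) x)) \<longlonglongrightarrow> L"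
      "\<And>n. 0 < n \<Longrightarrow> root n (return_prob (2 * n) x) \<le> L"
    by (rule supermultiplicative_root_convergent[of "\<lambda>n. return_prob (2 * n) x"])
       (simp_all add: return_prob_even_pos return_prob_le_1 return_prob_supermult distrib_left)
  have root: "root (2 * n) y = sqrt (root n y)" for n y
    by (simp add: real_root_mult_exp sqrt_def)
  have lim: "(\<lambda>n. root (2 * n) (return_prob (2 * n) x)) \<longlonglongrightarrow> sqrt L"
    unfolding root by (intro tendsto_intros L)
  then have q: "quenched_radius x = sqrt L"
    unfolding quenched_radius_def by (rule limI)
  show "(\<lambda>n. root (2 * n) (return_prob (2 * n) x)) \<longlonglongrightarrow> quenched_radius x"
    using lim by (simp add: q)
  show "root (2 * n) (return_prob (2 * n) x) \<le> quenched_radius x" if "0 < n"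
    unfolding root q using L(2)[OF that] by simp
qed

text \<open>Walking from \<open>b\<close> to \<open>a\<close>, around a closed walk at \<open>a\<close>, and back to \<open>b\<close> costs a factor
  \<open>c > 0\<close> independent of the length of the closed walk, and roots send \<open>c\<close> to one.  The same
  length \<open>k\<close> can be used in both directions because edges are symmetric, which keeps the total time
  even.\<close>

lemma quenched_radius_le_reroot:
  assumes G: "conn_graph G" "a \<in> verts G" "b \<in> verts G"
  shows "quenched_radius (abs_rooted_graph (G, a)) \<le> quenched_radius (abs_rooted_graph (G, b))"
    (is "quenched_radius ?x \<le> quenched_radius ?y")
proof -
  have conn: "(a, b) \<in> (edges G)\<^sup>*" and sym: "sym (edges G)"
    using G by (auto simp: conn_graph_def)
  obtain k where k: "(a, b) \<in> edges G ^^ k"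
    using conn by (auto simp: rtrancl_power)
  have "(b, a) \<in> edges G ^^ k"
    using sym k by (rule relpow_sym)
  define c where "c = pmf (srw G b k) a * pmf (srw G a k) b"
  have "0 < c"
    using k \<open>(b, a) \<in> edges G ^^ k\<close> G(1) by (simp add: c_def srw_pos_if_relpow)
  have detour: "c * return_prob (2 * n) ?x \<le> return_prob (2 * (n + k)) ?y" for n
  proof -
    have "pmf (srw G b k) a * pmf (srw G a (2 * n)) a * pmf (srw G a k) b
        \<le> pmf (srw G b (k + 2 * n)) a * pmf (srw G a k) b"
      by (intro mult_right_mono srw_compose_ge) simp
    also have "\<dots> \<le> pmf (srw G b (k + 2 * n + k)) b"
      by (rule srw_compose_ge)
    also have "k + 2 * n + k = 2 * (n + k)" by simp
    finally show ?thesis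
      using G by (simp add: return_prob_abs c_def mult.commute mult.left_commute)
  qed
  let ?\<rho> = "quenched_radius ?y"
  have \<rho>: "0 \<le> ?\<rho>" "?\<rho> \<le> 1"
  proof -
    have "0 \<le> root (2 * 1) (return_prob (2 * 1) ?y)"
      using return_prob_even_pos[of 1 ?y] by simp
    then show "0 \<le> ?\<rho>"
      using root_return_prob_le[of 1 ?y] by linarith
    have "root (2 * n) (return_prob (2 * n) ?y) \<le> 1" for n
      using return_prob_le_1[of "2 * n" ?y] by (cases "n = 0") auto
    then show "?\<rho> \<le> 1"
      by (intro LIMSEQ_le_const2[OF root_return_prob_tendsto]) auto
  qed
  have "root (2 * n) c * root (2 * n) (return_prob (2 * n) ?x) \<le> ?\<rho>" if "0 < n" for n
  proof -
    have "return_prob (2 * (n + k)) ?y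
        = root (2 * (n + k)) (return_prob (2 * (n + k)) ?y) ^ (2 * (n + k))"
      using that return_prob_even_pos[of "n + k" ?y] by (intro real_root_pow_pos2[symmetric]) auto
    also have "\<dots> \<le> ?\<rho> ^ (2 * (n + k))"
      using that return_prob_even_pos[of "n + k" ?y]
      by (intro power_mono root_return_prob_le) auto
    also have "\<dots> \<le> ?\<rho> ^ (2 * n)"
      using \<rho> by (intro power_decreasing) auto
    finally have "c * return_prob (2 * n) ?x \<le> ?\<rho> ^ (2 * n)"
      using detour[of n] by simp
    then have "root (2 * n) (c * return_prob (2 * n) ?x) \<le> root (2 * n) (?\<rho> ^ (2 * n))"
      using that by simp
    also have "\<dots> = ?\<rho>"
      using that \<rho>(1) by (intro real_root_power_cancel) auto
    finally show ?thesis by (simp add: real_root_mult)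
  qed
  moreover have "(\<lambda>n. root (2 * n) c * root (2 * n) (return_prob (2 * n) ?x))
      \<longlonglongrightarrow> 1 * quenched_radius ?x"
    using LIMSEQ_subseq_LIMSEQ[OF LIMSEQ_root_const[OF \<open>0 < c\<close>], of "\<lambda>n. 2 * n"]
    by (intro tendsto_mult root_return_prob_tendsto) (auto simp: strict_mono_def o_def)
  ultimately show ?thesis
    by (auto intro!: LIMSEQ_le_const2[of _ "quenched_radius ?x"] exI[of _ 1])
qed

lemma degrees_le_reroot:
  "conn_graph G \<Longrightarrow> a \<in> verts G \<Longrightarrow> b \<in> verts G \<Longrightarrow>
    degrees_le D (abs_rooted_graph (G, a)) \<longleftrightarrow> degrees_le D (abs_rooted_graph (G, b))"
  by (simp add: degrees_le.abs_eq[OF rooted_iso_refl])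

section \<open>Annealed and quenched spectral radii\<close>

theorem proposition1p5:
  fixes D :: nat and \<nu> :: "rooted_graph measure"
  assumes "unimodular D \<nu>"
  shows "ereal (annealed_radius \<nu>) = esssup \<nu> (\<lambda>x. ereal (quenched_radius x)) \<and>
         (ergodic \<nu> \<longrightarrow> (AE x in \<nu>. annealed_radius \<nu> = quenched_radius x))"
proof -
  have "prob_space \<nu>" and sets: "sets \<nu> = sets (rooted_space D)"
    using assms by (auto simp: unimodular_def)
  interpret prob_space \<nu> by fact
  have space: "space \<nu> = {x. degrees_le D x}"
    using sets_eq_imp_space_eq[OF sets] by (simp add: rooted_space_def space_restrict_space)
  have [measurable]: "return_prob n \<in> borel_measurable \<nu>" for n
    unfolding measurable_cong_sets[OF sets refl] rooted_space_def
    by (intro measurable_restrict_space1 borel_measurable_continuous_onI continuous_return_prob)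
  have [measurable]: "quenched_radius \<in> borel_measurable \<nu>"
    using root_return_prob_tendsto by (rule borel_measurable_LIMSEQ_real) measurable
  have even: "filterlim (\<lambda>n::nat. 2 * n) at_top sequentially"
    by (rule filterlim_subseq) (simp add: strict_mono_def)
  obtain L where L: "(\<lambda>n. root (2 * n) (\<integral>x. return_prob (2 * n) x \<partial>\<nu>)) \<longlonglongrightarrow> L"
      "ereal L = esssup \<nu> (\<lambda>x. ereal (quenched_radius x))"
    by (rule root_expectation_tendsto_esssup[OF \<open>prob_space \<nu>\<close> _ even,
          of "\<lambda>n. return_prob (2 * n)" quenched_radius])
       (simp_all add: root_return_prob_tendsto root_return_prob_le return_prob_le_1
          less_imp_le[OF return_prob_even_pos])
  have L_eq: "annealed_radius \<nu> = L"
    unfolding annealed_radius_def using L(1) by (rule limI)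
  have AE_le: "AE x in \<nu>. quenched_radius x \<le> L"
    using esssup_AE[where M = \<nu> and f = "\<lambda>x. ereal (quenched_radius x)"] unfolding L(2)[symmetric] by simp
  have "AE x in \<nu>. L = quenched_radius x" if erg: "ergodic \<nu>"
  proof -
    \<comment> \<open>The event \<open>{x. quenched_radius x < L}\<close> is invariant too, but it can be excluded from having
      full measure only after \<open>L\<close> is replaced by a smaller \<open>c\<close>.\<close>
    have above: "AE x in \<nu>. c < quenched_radius x" if "c < L" for c
    proof -
      define U where "U = {x \<in> space \<nu>. quenched_radius x \<le> c}"
      have [measurable]: "U \<in> sets \<nu>" unfolding U_def by measurable
      have "rerooting_invariant U"
        unfolding rerooting_invariant_def U_def space
        using order_trans[OF quenched_radius_le_reroot] degrees_le_reroot by blast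
      then have "measure \<nu> U \<in> {0, 1}"
        using erg by (simp add: ergodic_def)
      moreover have "measure \<nu> U \<noteq> 1"
      proof
        assume "measure \<nu> U = 1"
        then have "AE x in \<nu>. x \<in> U" by (simp add: AE_in_set_eq_1)
        then have "AE x in \<nu>. ereal (quenched_radius x) \<le> ereal c"
          by eventually_elim (simp add: U_def)
        then have "ereal L \<le> ereal c"
          unfolding L(2) by (intro esssup_I) auto
        with \<open>c < L\<close> show False by simp
      qed
      ultimately have "U \<in> null_sets \<nu>"
        by (auto simp: null_sets_def emeasure_eq_measure)
      then have "AE x in \<nu>. x \<notin> U" by (rule AE_not_in)
      then show ?thesis
        using AE_space by eventually_elim (auto simp: U_def)
    qed
    have "AE x in \<nu>. \<forall>n. L - 1 / Suc n < quenched_radius x"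
      unfolding AE_all_countable by (intro allI above) simp
    with AE_le show ?thesis
    proof eventually_elim
      case (elim x)
      have "L \<le> quenched_radius x"
      proof (rule ccontr)
        assume "\<not> ?thesis"
        then obtain n where "1 / Suc n < L - quenched_radius x"
          using nat_approx_posE[of "L - quenched_radius x"] by auto
        with elim(2)[rule_format, of n] show False by simp
      qed
      with elim(1) show ?case by simp
    qed
  qed
  with L(2) show ?thesis by (simp add: L_eq)
qed

end
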